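(* For every integer $n\ge 0$, the following identities hold as polynomials in $x$: $$H_{n}\left(\frac{B_{2k+1}\left(\frac{x+1}{2}\right)}{2k+1}\right)=\left(\frac{x}{2}\right)^{n+1}\prod_{\ell=1}^{n}\left(\frac{(2\ell)^{2}(2\ell-1)^{2}\,(x^{2}-(2\ell-1)^{2})\,(x^{2}-(2\ell)^{2})}{16(4\ell-3)(4\ell-1)^{2}(4\ell+1)}\right)^{n+1-\ell},$$ $$H_{n}\left(\frac{B_{2k+3}\left(\frac{x+1}{2}\right)}{2k+3}\right)=\left(\frac{x^{3}-x}{24}\right)^{n+1}\prod_{\ell=1}^{n}\left(\frac{(2\ell)^{2}(2\ell+1)^{2}\,(x^{2}-(2\ell+1)^{2})\,(x^{2}-(2\ell)^{2})}{16(4\ell-1)(4\ell+1)^{2}(4\ell+3)}\right)^{n+1-\ell}.$$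
   Context: $B_n(x)$ is the $n$th Bernoulli polynomial, defined by $\frac{te^{tx}}{e^t-1}=\sum_{n\ge 0}B_n(x)\frac{t^n}{n!}$. For a sequence $(c_k)_{k\ge 0}$, the Hankel determinant is $H_n(c_k):=\det(c_{i+j})_{0\le i,j\le n}$, the determinant of an $(n+1)\times(n+1)$ matrix; in each formula above $c_k$ is the displayed expression in $k\ge 0$. Empty products equal $1$. *)

theory Defs
  imports
    "HOL-Computational_Algebra.Computational_Algebra"
    "Jordan_Normal_Form.Determinant"
begin

hide_const (open) Module.smult

abbreviation polyX :: "'a::comm_ring_1 poly" where
  "polyX \<equiv> [:0, 1:]"

(* The generating function t e^(t x) / (e^t - 1), a power series in t over the polynomials in x.
   Polynomials do not form a field, so the quotient t / (e^t - 1) is taken over the coefficient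
   field and its coefficients are then embedded as constant polynomials; the second factor is
   e^(t x), with coefficients x^n / n!. *)
definition bernoulli_gf :: "'a::field_char_0 poly fps" where
  "bernoulli_gf =
     Abs_fps (\<lambda>n. [: fps_nth (fps_X / (fps_exp 1 - 1)) n :]) *
     Abs_fps (\<lambda>n. smult (1 / fact n) (polyX ^ n))"

definition bernoulli_poly :: "nat \<Rightarrow> 'a::field_char_0 poly" where
  "bernoulli_poly n = smult (fact n) (fps_nth bernoulli_gf n)"

lemma bernoulli_poly_gf:
  fixes x :: "'a::field_char_0"
  shows "Abs_fps (\<lambda>n. poly (bernoulli_poly n) x / fact n)
           = fps_X * fps_exp x / (fps_exp 1 - 1)"
proof -
  let ?E = "fps_exp 1 - 1 :: 'a fps"
  have "fps_nth ?E 1 \<noteq> 0"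
    by simp
  then have nz: "?E \<noteq> 0"
    by fastforce
  have "subdegree ?E \<le> 1"
    by (rule subdegree_leI) simp
  then have "?E dvd fps_X"
    by (subst fps_dvd_iff) (use nz in auto)
  then have "fps_X * fps_exp x / ?E = (fps_X / ?E) * fps_exp x"
    by (metis div_mult_swap mult.commute)
  moreover have "Abs_fps (\<lambda>n. poly (bernoulli_poly n) x / fact n) = (fps_X / ?E) * fps_exp x"
    by (rule fps_ext)
       (simp add: bernoulli_poly_def bernoulli_gf_def fps_mult_nth poly_sum poly_power)
  ultimately show ?thesis
    by simp
qed

definition hankel_det :: "nat \<Rightarrow> (nat \<Rightarrow> 'a::comm_ring_1) \<Rightarrow> 'a" where
  "hankel_det n c = det (mat (n + 1) (n + 1) (\<lambda>(i, j). c (i + j)))"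

end

theory Submission
  imports Defs
begin

text \<open>
  Both sides are polynomials in \<open>x\<close>, so it is enough to compare them at every natural number \<open>N\<close>. There
  telescoping and the symmetry of the Bernoulli polynomials turn \<open>B\<^bsub>2k+1\<^esub>((N+1)/2) / (2k+1)\<close> into half of
  the power sum of exponent \<open>2k\<close> over the \<open>N\<close> points \<open>j - (N-1)/2\<close>, \<open>j < N\<close>, that is, into an even moment of a
  symmetric discrete measure. Its monic orthogonal polynomials are the discrete Chebyshev polynomials
  \<open>P\<^bsub>k+1\<^esub> = X P\<^sub>k - \<gamma>\<^sub>k P\<^bsub>k-1\<^esub>\<close> with \<open>\<gamma>\<^sub>k = k\<^sup>2 (N\<^sup>2 - k\<^sup>2) / (4 (4 k\<^sup>2 - 1))\<close>. By Favard's argument,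
  orthogonality reduces to \<open>P\<^sub>k\<close> having integral zero for \<open>k > 0\<close>, which is a telescoping
  alternating sum. As \<open>P\<^sub>k\<close> has the parity of \<open>k\<close>, the coefficients of the \<open>P\<^bsub>2i+e\<^esub>\<close> form a unitriangular matrix
  for \<open>e = 0\<close> and for \<open>e = 1\<close>, and multiplying the Hankel matrix by it gives a triangular matrix whose
  diagonal consists of the squared norms of the \<open>P\<^bsub>2i+e\<^esub>\<close>, which are products of the \<open>\<gamma>\<^sub>j\<close>.
\<close>

section \<open>Three-term recurrences, Favard functionals and Hankel determinants of even
  moments\<close>

fun ops :: "(nat \<Rightarrow> 'a) \<Rightarrow> nat \<Rightarrow> 'a::comm_ring_1 poly" where
  "ops g 0 = 1"
| "ops g (Suc 0) = polyX"
| "ops g (Suc (Suc k)) = polyX * ops g (Suc k) - smult (g (Suc k)) (ops g k)"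

lemma coeff_ops_eq_0: "k < m \<or> odd (k + m) \<Longrightarrow> coeff (ops g k) m = 0"
proof (induction g k arbitrary: m rule: ops.induct)
  case (1 g)
  then show ?case by (cases m) auto
next
  case (2 g)
  then show ?case by (auto simp: coeff_pCons split: nat.splits)
next
  case (3 g k)
  have "coeff (polyX * ops g (Suc k)) m = 0"
    using 3(1)[of "m - 1"] "3.prems" by (cases m) auto
  moreover have "coeff (ops g k) m = 0"
    by (rule 3(2)) (use "3.prems" in auto)
  ultimately show ?case by simp
qed

lemma coeff_ops_self: "coeff (ops g k) k = 1"
  by (induction g k rule: ops.induct) (simp_all add: coeff_ops_eq_0)

text \<open>Abstracts the discrete measure to a linear functional that kills every
  \<open>ops g k\<close> of positive degree; full orthogonality follows from the recurrence.\<close>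

locale favard_functional =
  fixes L :: "'a::comm_ring_1 poly \<Rightarrow> 'a" and g :: "nat \<Rightarrow> 'a"
  assumes L_add: "L (p + q) = L p + L q"
    and L_smult: "L (smult a p) = a * L p"
    and L_ops: "0 < k \<Longrightarrow> L (ops g k) = 0"
begin

lemma L_sum: "finite A \<Longrightarrow> L (\<Sum>i\<in>A. f i) = (\<Sum>i\<in>A. L (f i))"
proof (induction A rule: finite_induct)
  case empty
  then show ?case using L_smult[of 0 0] by simp
qed (simp add: L_add)

text \<open>The recurrence, read as X P_k = P_(k+1) + g_k P_(k-1), trades one power of X for a shift
  of the index. Only the path k, k-1, ..., 0 reaches the constant polynomial, and it collects each
  factor \<open>g i\<close> once.\<close>

lemma L_ops_mult_power:
  "j \<le> k \<Longrightarrow> L (ops g k * polyX ^ j) = (if j = k then L 1 * (\<Prod>i=1..k. g i) else 0)"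
proof (induction j arbitrary: k)
  case 0
  then show ?case by (simp add: L_ops)
next
  case (Suc j)
  then obtain k' where k: "k = Suc k'" by (cases k) auto
  have "ops g k * polyX ^ Suc j = ops g (Suc k) * polyX ^ j + smult (g k) (ops g k' * polyX ^ j)"
    unfolding k by (simp add: algebra_simps)
  then have "L (ops g k * polyX ^ Suc j) = L (ops g (Suc k) * polyX ^ j) + g k * L (ops g k' * polyX ^ j)"
    by (metis L_add L_smult)
  then show ?case
    using Suc.prems k by (simp add: Suc.IH prod.nat_ivl_Suc' del: ops.simps mult_pCons_left mult_pCons_right)
qed

lemma hankel_det_even_moments:
  assumes e: "e \<le> 1"
  shows "hankel_det n (\<lambda>k. L (polyX ^ (2 * k + 2 * e))) =
           (\<Prod>i\<le>n. L 1 * (\<Prod>j=1..2 * i + e. g j))"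
proof -
  let ?H = "mat (n + 1) (n + 1) (\<lambda>(i, j). L (polyX ^ (2 * (i + j) + 2 * e)))"
  let ?A = "mat (n + 1) (n + 1) (\<lambda>(i, j). coeff (ops g (2 * i + e)) (2 * j + e))"
  \<comment> \<open>The sum runs over the full row length \<open>n + 1\<close>, not only up to
    \<open>i\<close>, to match the matrix product; the extra coefficients vanish by degree.\<close>
  have ops_eq: "ops g (2 * i + e) = (\<Sum>j<n + 1. smult (coeff (ops g (2 * i + e)) (2 * j + e)) (polyX ^ (2 * j + e)))"
    if "i \<le> n" for i
  proof (rule poly_eqI)
    fix m
    have "coeff (\<Sum>j<n + 1. smult (coeff (ops g (2 * i + e)) (2 * j + e)) (polyX ^ (2 * j + e))) m
      = (\<Sum>j<n + 1. if m = 2 * j + e then coeff (ops g (2 * i + e)) m else 0)"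
      by (auto simp: coeff_sum monom_altdef[symmetric, of 1, simplified] intro!: sum.cong)
    also have "\<dots> = coeff (ops g (2 * i + e)) m"
    proof (cases "even (m + e) \<and> e \<le> m \<and> m \<le> 2 * i + e")
      case True
      then have "even (m - e)" by auto
      then obtain j where "m - e = 2 * j" by blast
      then have "m = 2 * j + e" using True by auto
      moreover have "j < n + 1" using True that calculation by auto
      ultimately show ?thesis
        by (subst sum.mono_neutral_right[of _ "{j}"]) auto
    next
      case False
      \<comment> \<open>The case \<open>m < e\<close> falls under the parity alternative:
        \<open>e \<le> 1\<close> then forces \<open>m = 0\<close> and \<open>e = 1\<close>.\<close>
      then have "odd (2 * i + e + m) \<or> 2 * i + e < m"
        using e by (cases "e = 0"; cases "m = 0") auto
      then have "coeff (ops g (2 * i + e)) m = 0"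
        by (intro coeff_ops_eq_0) auto
      then show ?thesis by (simp only: if_cancel sum.neutral_const)
    qed
    finally show "coeff (ops g (2 * i + e)) m = coeff (\<Sum>j<n + 1. smult (coeff (ops g (2 * i + e)) (2 * j + e)) (polyX ^ (2 * j + e))) m" ..
  qed
  \<comment> \<open>The exponent \<open>2 * (j + k) + 2 * e\<close> splits as (2j+e) + (2k+e): the
    first part assembles row \<open>i\<close> into \<open>ops g (2 * i + e)\<close>, the second is
    the test power. The entry vanishes for k < i.\<close>
  have entry: "(?A * ?H) $$ (i, k) = L (ops g (2 * i + e) * polyX ^ (2 * k + e))"
    if "i < n + 1" "k < n + 1" for i k
  proof -
    have "(?A * ?H) $$ (i, k) = (\<Sum>j<n + 1. coeff (ops g (2 * i + e)) (2 * j + e) * L (polyX ^ (2 * (j + k) + 2 * e)))"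
      using that by (simp add: scalar_prod_def atLeast0LessThan)
    also have "\<dots> = L (\<Sum>j<n + 1. smult (coeff (ops g (2 * i + e)) (2 * j + e)) (polyX ^ (2 * j + e)) * polyX ^ (2 * k + e))"
      by (simp add: L_sum L_add L_smult power_add[symmetric] algebra_simps)
    also have "\<dots> = L (ops g (2 * i + e) * polyX ^ (2 * k + e))"
      by (subst sum_distrib_right[symmetric], subst ops_eq[symmetric]) (use that in auto)
    finally show ?thesis .
  qed
  have "det ?A = prod_list (diag_mat ?A)"
    by (rule det_lower_triangular[of "n + 1"]) (auto simp: coeff_ops_eq_0)
  also have "\<dots> = 1"
    by (auto simp: prod_list_diag_prod coeff_ops_self)
  finally have "det ?H = det ?A * det ?H" by simp
  also have "\<dots> = det (?A * ?H)"
    by (rule det_mult[symmetric]) auto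
  also have "\<dots> = prod_list (diag_mat (?A * ?H))"
    by (rule det_upper_triangular)
       (auto simp: entry[simplified] L_ops_mult_power simp del: index_mult_mat(1) intro!: upper_triangularI)
  also have "\<dots> = (\<Prod>i<n + 1. (?A * ?H) $$ (i, i))"
    by (simp add: prod_list_diag_prod atLeast0LessThan del: index_mult_mat(1))
  also have "\<dots> = (\<Prod>i\<le>n. L 1 * (\<Prod>j=1..2 * i + e. g j))"
    by (intro prod.cong) (auto simp: entry[simplified] L_ops_mult_power simp del: index_mult_mat(1))
  finally show ?thesis
    by (simp add: hankel_det_def)
qed

end

text \<open>The factor \<open>f l\<close> occurs in the inner products with l \<le> i \<le> n, hence
  n + 1 - l times.\<close>

lemma prod_prod_partial:
  fixes f :: "nat \<Rightarrow> 'a::comm_monoid_mult"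
  shows "(\<Prod>i\<le>n. a * (\<Prod>l=1..i. f l)) = a ^ (n + 1) * (\<Prod>l=1..n. f l ^ (n + 1 - l))"
proof (induction n)
  case (Suc n)
  have "(\<Prod>l=1..Suc n. f l ^ (Suc n + 1 - l)) = (\<Prod>l=1..n. f l ^ (n + 1 - l) * f l) * f (Suc n)"
    by (simp add: Suc_diff_le mult_ac)
  with Suc show ?case
    by (simp add: prod.distrib mult_ac)
qed simp

section \<open>Discrete Chebyshev polynomials and their recurrence\<close>

text \<open>Up to the factor \<open>fact k ^ 2 / fact (2 * k)\<close>, these are the coefficients of the monic
  discrete Chebyshev polynomial of degree \<open>k\<close> on \<open>{0..<N}\<close> in the basis of falling factorials.\<close>

definition cheb_coeff :: "'a::field_char_0 \<Rightarrow> nat \<Rightarrow> nat \<Rightarrow> 'a" where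
  "cheb_coeff N k i = (if i \<le> k then
     fact (k + i) / (fact (k - i) * fact i ^ 2) * pochhammer (of_nat i + 1 - N) (k - i) else 0)"

text \<open>The classical recurrence of the discrete Chebyshev polynomials, compared
  coefficientwise. Multiplication by the variable sends the falling factorial of order i to the one
  of order i + 1 plus i times itself, whence the terms with \<open>i - 1\<close> and
  \<open>of_nat i\<close>.\<close>

lemma cheb_coeff_rec:
  fixes N :: "'a::field_char_0"
  shows "of_nat (k + 2) * cheb_coeff N (k + 2) i =
    2 * of_nat (2 * k + 3) * ((if i = 0 then 0 else cheb_coeff N (k + 1) (i - 1)) +
       (of_nat i - (N - 1) / 2) * cheb_coeff N (k + 1) i)
    - of_nat (k + 1) * (N\<^sup>2 - of_nat (k + 1) ^ 2) * cheb_coeff N k i"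
proof -
  \<comment> \<open>Case b is the generic range 1 \<le> i \<le> k, with \<open>m\<close> and
    \<open>d\<close> replacing truncated differences. In the others some coefficient lies outside
    its support or there is no predecessor of \<open>i\<close>.\<close>
  consider (a) "i = 0" | (b) m d where "i = Suc m" "k = Suc m + d" | (c) "i = k + 1" | (d) "i = k + 2" | (e) "k + 2 < i"
    by (metis Suc_eq_plus1 add_2_eq_Suc' le_Suc_ex not_less_eq_eq not0_implies_Suc linorder_neqE_nat less_eq_Suc_le)
  then show ?thesis
  proof cases
    case a
    define p where "p = pochhammer (1 - N) k"
    have nz: "(of_nat k + 1 :: 'a) \<noteq> 0" "(of_nat k + 2 :: 'a) \<noteq> 0"
      using of_nat_neq_0[of k, where 'a='a] of_nat_neq_0[of "Suc k", where 'a='a] by (simp_all add: algebra_simps)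
    show ?thesis unfolding a cheb_coeff_def
      using nz by (simp add: pochhammer_Suc p_def[symmetric]) (simp add: field_simps power2_eq_square)
  next
    case b
    define p where "p = pochhammer (of_nat m + 2 - N) d"
    define M where "M = (fact m :: 'a)"
    define D where "D = (fact d :: 'a)"
    define A where "A = (fact (2 + 2 * m + d) :: 'a)"
    have nz: "M \<noteq> 0" "D \<noteq> 0" "(of_nat m + 1 :: 'a) \<noteq> 0" "(of_nat d + 1 :: 'a) \<noteq> 0" "(of_nat d + 2 :: 'a) \<noteq> 0"
      using of_nat_neq_0[of m, where 'a='a] of_nat_neq_0[of d, where 'a='a] of_nat_neq_0[of "Suc d", where 'a='a]
      by (simp_all add: M_def D_def algebra_simps)
    define x y :: 'a where "x = of_nat m" and "y = of_nat d"
    have f1: "fact (k + i) = A" "fact (k + 1 + m) = A" "fact (k + 1 + i) = (2 * x + y + 3) * A"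
       "fact (k + 2 + i) = (2 * x + y + 4) * (2 * x + y + 3) * A"
      unfolding b x_def y_def A_def
      by (simp_all add: algebra_simps numeral_eq_Suc)
    have f2: "fact (k - i) = D" "fact (k + 1 - m) = (y + 2) * (y + 1) * D" "fact (k + 1 - i) = (y + 1) * D"
       "fact (k + 2 - i) = (y + 2) * (y + 1) * D" "fact i = (x + 1) * M"
      unfolding b x_def y_def D_def M_def
      by (simp_all add: algebra_simps numeral_eq_Suc)
    have p0: "pochhammer (of_nat i + 1 - N) d = p" by (simp add: p_def b add_ac)
    have p: "pochhammer (of_nat i + 1 - N) (k - i) = p"
      "pochhammer (of_nat i + 1 - N) (k + 1 - i) = p * (x + y + 2 - N)"
      "pochhammer (of_nat i + 1 - N) (k + 2 - i) = p * (x + y + 2 - N) * (x + y + 3 - N)"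
      "pochhammer (of_nat m + 1 - N) (k + 1 - m) = (x + 1 - N) * p * (x + y + 2 - N)"
    proof -
      have "k - i = d" "k + 1 - i = Suc d" "k + 2 - i = Suc (Suc d)" "k + 1 - m = Suc (Suc d)"
        using b by auto
      then show "pochhammer (of_nat i + 1 - N) (k - i) = p"
      "pochhammer (of_nat i + 1 - N) (k + 1 - i) = p * (x + y + 2 - N)"
      "pochhammer (of_nat i + 1 - N) (k + 2 - i) = p * (x + y + 2 - N) * (x + y + 3 - N)"
        by (simp_all add: pochhammer_Suc p0) (simp_all add: b x_def y_def algebra_simps)
      have "pochhammer (of_nat m + 1 - N) (Suc (Suc d)) = (of_nat m + 1 - N) * pochhammer (of_nat i + 1 - N) (Suc d)"
        by (subst pochhammer_rec) (simp add: b algebra_simps)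
      also have "pochhammer (of_nat i + 1 - N) (Suc d) = p * (x + y + 2 - N)"
        unfolding pochhammer_Suc p0 by (simp add: b x_def y_def algebra_simps)
      finally show "pochhammer (of_nat m + 1 - N) (k + 1 - m) = (x + 1 - N) * p * (x + y + 2 - N)"
        using \<open>k + 1 - m = Suc (Suc d)\<close> by (simp add: x_def)
    qed
    have c: "cheb_coeff N (k + 2) i = (2 * x + y + 4) * (2 * x + y + 3) * A / ((y + 2) * (y + 1) * D * ((x + 1) * M)\<^sup>2)
       
        * (p * (x + y + 2 - N) * (x + y + 3 - N))"
      "cheb_coeff N (k + 1) i = (2 * x + y + 3) * A / ((y + 1) * D * ((x + 1) * M)\<^sup>2) * (p * (x + y + 2 - N))"
      "cheb_coeff N (k + 1) (i - 1) = A / ((y + 2) * (y + 1) * D * M\<^sup>2) * ((x + 1 - N) * p * (x + y + 2 - N))"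
      "cheb_coeff N k i = A / (D * ((x + 1) * M)\<^sup>2) * p"
      unfolding cheb_coeff_def f1 f2 p using b f1(2) f2(2) p(4) by (simp_all add: M_def)
    have o: "of_nat (k + 2) = x + y + 3" "of_nat (2 * k + 3) = 2 * x + 2 * y + 5" "of_nat i = x + 1" "of_nat (k + 1) = x + y + 2"
      "i \<noteq> 0"
      by (simp_all add: b x_def y_def)
    have nz': "x + 1 \<noteq> 0" "y + 1 \<noteq> 0" "y + 2 \<noteq> 0" using nz by (simp_all add: x_def y_def)
    \<comment> \<open>All four coefficients are polynomial multiples of \<open>W\<close>, so the
      claim becomes a polynomial identity without division.\<close>
    define W where "W = A * p / ((y + 2) * (y + 1) * D * ((x + 1) * M)\<^sup>2)"
    have c': "cheb_coeff N (k + 2) i = W * ((2 * x + y + 4) * (2 * x + y + 3) * (x + y + 2 - N) * (x + y + 3 - N))"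
      "cheb_coeff N (k + 1) i = W * ((2 * x + y + 3) * (y + 2) * (x + y + 2 - N))"
      "cheb_coeff N (k + 1) (i - 1) = W * ((x + 1)\<^sup>2 * (x + 1 - N) * (x + y + 2 - N))"
      "cheb_coeff N k i = W * ((y + 2) * (y + 1))"
      unfolding c W_def using nz(1,2) nz'
      by (simp_all add: power_mult_distrib mult_ac)
    show ?thesis
    proof -
      \<comment> \<open>Writing \<open>N\<close> through \<open>h\<close> removes the remaining
        halves.\<close>
      define h where "h = (N - 1) / 2"
      have N: "N = 2 * h + 1" by (simp add: h_def field_simps)
      show ?thesis
        unfolding c' o if_not_P[OF o(5)] h_def[symmetric] unfolding N by (simp add: algebra_simps power2_eq_square)
    qed
  next
    case c
    define F where "F = (fact (2 * k + 1) :: 'a)"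
    define M where "M = (fact k :: 'a)"
    define x :: 'a where "x = of_nat k"
    have nz: "M \<noteq> 0" "x + 1 \<noteq> 0" 
      using of_nat_neq_0[of k, where 'a='a] by (simp_all add: M_def x_def add_ac)
    define W where "W = F / ((x + 1) * M\<^sup>2)"
    have f: "fact (k + 2 + (k + 1)) = (2 * x + 3) * (2 * (x + 1)) * F" "fact (k + 1 + (k + 1)) = 2 * (x + 1) * F" "fact (k + 1 + k) = F"
       "fact (k + 1) = (x + 1) * M"
      unfolding F_def x_def M_def by (simp_all add: algebra_simps numeral_eq_Suc)
    have o: "of_nat (k + 1) + 1 - N = x + 2 - N" "of_nat k + 1 - N = x + 1 - N"
      "k + 2 - (k + 1) = 1" "k + 1 - (k + 1) = 0" "k + 1 - k = 1" "k + 1 - 1 = k"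
      by (simp_all add: x_def)
    have "cheb_coeff N (k + 2) i = (2 * x + 3) * (2 * (x + 1)) * F / ((x + 1) * M)\<^sup>2 * (x + 2 - N)"
      "cheb_coeff N (k + 1) i = 2 * (x + 1) * F / ((x + 1) * M)\<^sup>2"
      "cheb_coeff N (k + 1) (i - 1) = F / M\<^sup>2 * (x + 1 - N)"
      "cheb_coeff N k i = 0"
      unfolding cheb_coeff_def c o f by (simp_all add: M_def)
    then have c': "cheb_coeff N (k + 2) i = W * ((2 * x + 3) * 2 * (x + 2 - N))"
      "cheb_coeff N (k + 1) i = W * 2" "cheb_coeff N (k + 1) (i - 1) = W * ((x + 1) * (x + 1 - N))"
      "cheb_coeff N k i = 0"
      using nz by (simp_all add: W_def power2_eq_square mult_ac del: distrib_left_numeral distrib_right_numeral)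
    show ?thesis
      unfolding c' using c by (simp add: x_def[symmetric] field_simps)
  next
    case d
    define F where "F = (fact (2 * k + 2) :: 'a)"
    define M where "M = (fact (k + 1) :: 'a)"
    define x :: 'a where "x = of_nat k"
    have "M \<noteq> 0"
      unfolding M_def by (rule fact_nonzero)
    moreover have "x + 2 \<noteq> 0"
      using of_nat_neq_0[of "Suc k", where 'a='a] by (simp add: x_def add_ac)
    ultimately have nz: "M \<noteq> 0" "x + 2 \<noteq> 0" .
    have f: "fact (k + 2 + (k + 2)) = 2 * (x + 2) * (2 * x + 3) * F" "fact (k + 1 + (k + 1)) = F"
       "fact (k + 2) = (x + 2) * M"
      unfolding F_def x_def M_def by (simp_all add: algebra_simps numeral_eq_Suc)
    have o: "k + 2 - (k + 2) = 0" "k + 1 - (k + 1) = 0" "k + 2 - 1 = k + 1"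
      by simp_all
    define W where "W = F / ((x + 2) * M\<^sup>2)"
    have "cheb_coeff N (k + 2) i = 2 * (x + 2) * (2 * x + 3) * F / ((x + 2) * M)\<^sup>2"
      "cheb_coeff N (k + 1) i = 0" "cheb_coeff N k i = 0"
      "cheb_coeff N (k + 1) (i - 1) = F / M\<^sup>2"
      unfolding cheb_coeff_def d o f by (simp_all add: M_def)
    then have c': "cheb_coeff N (k + 2) i = W * (2 * (2 * x + 3))"
      "cheb_coeff N (k + 1) i = 0" "cheb_coeff N k i = 0"
      "cheb_coeff N (k + 1) (i - 1) = W * (x + 2)"
      using nz by (simp_all add: W_def power2_eq_square mult_ac
          del: distrib_left_numeral distrib_right_numeral)
    show ?thesis
      unfolding c' using d by (simp add: x_def[symmetric] algebra_simps)
  next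
    case e
    then show ?thesis by (simp add: cheb_coeff_def)
  qed
qed

definition cheb_rec :: "'a::field_char_0 \<Rightarrow> nat \<Rightarrow> 'a" where
  "cheb_rec N k = of_nat k ^ 2 * (N\<^sup>2 - of_nat k ^ 2) / (4 * (4 * of_nat k ^ 2 - 1))"

text \<open>\<open>cheb_coeff_rec\<close> summed against the falling factorials of \<open>y\<close>;
  here the leading coefficients are still central binomials, not 1.\<close>

lemma cheb_sum_rec:
  fixes N y :: "'a::field_char_0"
  defines "S \<equiv> \<lambda>k. \<Sum>i\<le>k. cheb_coeff N k i * (fact i * (y gchoose i))"
  shows "of_nat (k + 2) * S (k + 2) = 2 * of_nat (2 * k + 3) * ((y - (N - 1) / 2) * S (k + 1))
    - of_nat (k + 1) * (N\<^sup>2 - of_nat (k + 1) ^ 2) * S k"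
proof -
  define F where "F i = fact i * (y gchoose i)" for i
  have F: "y * F i = F (Suc i) + of_nat i * F i" for i
  proof -
    have "y * F i = fact i * (y * (y gchoose i))"
      by (simp add: F_def)
    also have "\<dots> = F (Suc i) + of_nat i * F i"
      unfolding gbinomial_mult_1 by (simp add: F_def algebra_simps)
    finally show ?thesis .
  qed
  \<comment> \<open>Coefficients beyond the degree vanish, so all three sums can share the range up
    to k + 2.\<close>
  have S: "S m = (\<Sum>i\<le>n. cheb_coeff N m i * F i)" if "m \<le> n" for m n
    unfolding S_def F_def by (rule sum.mono_neutral_left) (use that in \<open>auto simp: cheb_coeff_def\<close>)
  have S0: "S k = (\<Sum>i\<le>k+2. cheb_coeff N k i * F i)"
    and S1: "S (k + 1) = (\<Sum>i\<le>k+2. cheb_coeff N (k + 1) i * F i)"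
    and S2: "S (k + 2) = (\<Sum>i\<le>k+2. cheb_coeff N (k + 2) i * F i)"
    by (rule S, simp)+
  have "(y - (N - 1) / 2) * S (k + 1) = y * S (k + 1) - (N - 1) / 2 * S (k + 1)"
    by (rule left_diff_distrib)
  also have "y * S (k + 1) = (\<Sum>i\<le>k+1. cheb_coeff N (k + 1) i * (y * F i))"
    unfolding S[OF order_refl] sum_distrib_left by (intro sum.cong refl) (simp only: mult_ac)
  also have "\<dots> = (\<Sum>i\<le>k+1. cheb_coeff N (k + 1) i * F (Suc i)) +
      (\<Sum>i\<le>k+1. of_nat i * cheb_coeff N (k + 1) i * F i)"
    unfolding F by (simp add: distrib_left sum.distrib mult_ac del: sum.atMost_Suc)
  also have "(\<Sum>i\<le>k+1. cheb_coeff N (k + 1) i * F (Suc i)) =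
      (\<Sum>i\<le>k+2. (if i = 0 then 0 else cheb_coeff N (k + 1) (i - 1)) * F i)"
    using sum.atMost_Suc_shift[of "\<lambda>i. (if i = 0 then 0 else cheb_coeff N (k + 1) (i - 1)) * F i" "k + 1"]
    by (simp del: sum.atMost_Suc)
  also have "(\<Sum>i\<le>k+1. of_nat i * cheb_coeff N (k + 1) i * F i) =
      (\<Sum>i\<le>k+2. of_nat i * cheb_coeff N (k + 1) i * F i)"
    by (rule sum.mono_neutral_left) (auto simp: cheb_coeff_def)
  also have "(N - 1) / 2 * S (k + 1) = (\<Sum>i\<le>k+2. (N - 1) / 2 * cheb_coeff N (k + 1) i * F i)"
    unfolding S1 sum_distrib_left by (simp only: mult.assoc)
  finally have "(y - (N - 1) / 2) * S (k + 1) =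
      (\<Sum>i\<le>k+2. ((if i = 0 then 0 else cheb_coeff N (k + 1) (i - 1)) +
         (of_nat i - (N - 1) / 2) * cheb_coeff N (k + 1) i) * F i)"
    by (simp only: sum.distrib sum_subtractf distrib_right left_diff_distrib add_diff_eq)
  then have "2 * of_nat (2 * k + 3) * ((y - (N - 1) / 2) * S (k + 1))
      - of_nat (k + 1) * (N\<^sup>2 - of_nat (k + 1) ^ 2) * S k =
      (\<Sum>i\<le>k+2. (2 * of_nat (2 * k + 3) * ((if i = 0 then 0 else cheb_coeff N (k + 1) (i - 1)) +
       (of_nat i - (N - 1) / 2) * cheb_coeff N (k + 1) i)
    - of_nat (k + 1) * (N\<^sup>2 - of_nat (k + 1) ^ 2) * cheb_coeff N k i) * F i)"
    by (simp only: S0 sum_distrib_left sum_subtractf[symmetric] left_diff_distrib mult.assoc)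
  also have "\<dots> = of_nat (k + 2) * S (k + 2)"
    by (simp only: cheb_coeff_rec[symmetric]) (simp only: S2 sum_distrib_left mult.assoc)
  finally show ?thesis ..
qed

text \<open>The shift centres the points 0, ..., N-1 at the origin, and the prefactor, a reciprocal
  central binomial, makes the polynomial monic. Both sides then satisfy the same recurrence with the
  same initial values.\<close>

lemma poly_ops_cheb_rec:
  fixes N y :: "'a::field_char_0"
  shows "poly (ops (cheb_rec N) k) (y - (N - 1) / 2) =
    fact k ^ 2 / fact (2 * k) * (\<Sum>i\<le>k. cheb_coeff N k i * (fact i * (y gchoose i)))"
    (is "?P k = ?K k * ?S k")
proof (induction k rule: induct_nat_012)
  case 0
  show ?case by (simp add: cheb_coeff_def)
next
  case 1
  show ?case by (simp add: cheb_coeff_def field_simps)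
next
  case (ge2 k)
  define x :: 'a where "x = of_nat k"
  have nz: "x + 1 \<noteq> 0" "x + 2 \<noteq> 0" "2 * x + 1 \<noteq> 0" "2 * x + 3 \<noteq> 0"
    using of_nat_neq_0[of k, where 'a='a] of_nat_neq_0[of "k + 1", where 'a='a]
      of_nat_neq_0[of "2 * k", where 'a='a] of_nat_neq_0[of "2 * k + 2", where 'a='a]
    by (simp_all add: x_def add_ac)
  have K1: "?K (Suc k) = ?K k * ((x + 1) / (2 * (2 * x + 1)))"
  proof -
    have f: "fact (2 * Suc k) = 2 * (x + 1) * (2 * x + 1) * (fact (2 * k) :: 'a)"
      "fact (Suc k) = (x + 1) * (fact k :: 'a)"
      by (simp_all add: x_def algebra_simps)
    show ?thesis
      unfolding f using nz by (simp add: power2_eq_square mult_ac del: distrib_left_numeral distrib_right_numeral)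
  qed
  have K2: "?K (Suc (Suc k)) = ?K (Suc k) * ((x + 2) / (2 * (2 * x + 3)))"
  proof -
    have f: "fact (2 * Suc (Suc k)) = 2 * (x + 2) * (2 * x + 3) * (fact (2 * Suc k) :: 'a)"
      "fact (Suc (Suc k)) = (x + 2) * (fact (Suc k) :: 'a)"
      by (simp_all add: x_def algebra_simps)
    show ?thesis
      unfolding f using nz
      by (simp add: power2_eq_square mult_ac del: fact_Suc distrib_left_numeral distrib_right_numeral)
  qed
  have rec: "(x + 2) * ?S (Suc (Suc k)) = 2 * (2 * x + 3) * ((y - (N - 1) / 2) * ?S (Suc k)) - (x + 1) * (N\<^sup>2 - (x + 1)\<^sup>2) * ?S k"
    using cheb_sum_rec[of k N y] by (simp add: x_def add_ac del: sum.atMost_Suc)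
  define s0 s1 s2 K z where "s0 = ?S k" and "s1 = ?S (Suc k)" and "s2 = ?S (Suc (Suc k))" and "K = ?K k" and "z = y - (N - 1) / 2"
  note defs = s0_def[symmetric] s1_def[symmetric] s2_def[symmetric] z_def[symmetric]
  \<comment> \<open>Uses 4(k+1)^2 - 1 = (2k+1)(2k+3); the two factors match the denominators in
    \<open>K1\<close> and \<open>K2\<close>.\<close>
  have g: "cheb_rec N (Suc k) = (x + 1)\<^sup>2 * (N\<^sup>2 - (x + 1)\<^sup>2) / (4 * (2 * x + 1) * (2 * x + 3))"
    unfolding cheb_rec_def by (rule arg_cong2[of _ _ _ _ "(/)"]) (simp_all add: x_def algebra_simps power2_eq_square)
  have "?P (Suc (Suc k)) = z * ?P (Suc k) - cheb_rec N (Suc k) * ?P k"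
    by (simp add: z_def)
  also have "\<dots> = z * (?K (Suc k) * s1) - cheb_rec N (Suc k) * (?K k * s0)"
    by (simp only: ge2 s0_def s1_def)
  also have "\<dots> = ?K (Suc k) / (2 * (2 * x + 3)) * (2 * (2 * x + 3) * (z * s1) - (x + 1) * (N\<^sup>2 - (x + 1)\<^sup>2) * s0)"
  proof -
    have "z * (K * (c / (2 * a)) * s1) - c\<^sup>2 * Q / (4 * a * b) * (K * s0) =
        K * (c / (2 * a)) / (2 * b) * (2 * b * (z * s1) - c * Q * s0)"
      if "a \<noteq> 0" "b \<noteq> 0" for a b c Q :: 'a
      using that by (simp add: right_diff_distrib power2_eq_square mult_ac)
    then show ?thesis
      unfolding g K1 K_def[symmetric] using nz by blast
  qed
  also have "\<dots> = ?K (Suc k) / (2 * (2 * x + 3)) * ((x + 2) * s2)"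
    unfolding rec[unfolded defs] ..
  also have "\<dots> = ?K (Suc (Suc k)) * s2"
    unfolding K2 by simp
  finally show ?case unfolding s2_def .
qed

section \<open>Vanishing of the integrals over the discrete measure\<close>

text \<open>A closed form for partial sums makes induction on \<open>m\<close> possible. The factor
  \<open>of_nat (k - m)\<close> is left uncancelled so that the full sum, \<open>m = k\<close>, is
  visibly zero.\<close>

lemma alternating_fact_sum:
  assumes "m \<le> k" "0 < k"
  shows "(\<Sum>i\<le>m. (-1) ^ i * fact (k + i) / (fact (k - i) * fact i * fact (Suc i))) =
    ((-1) ^ m * of_nat (k - m) * fact (k + m + 1) /
     (fact (k - m) * fact m * fact (Suc m) * of_nat k * of_nat (k + 1)) :: 'a::field_char_0)"
  using assms(1)
proof (induction m)
  case 0
  then show ?case using \<open>0 < k\<close> of_nat_neq_0[of k, where 'a='a] by simp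
next
  case (Suc m)
  then obtain d where k: "k = Suc m + d"
    using le_Suc_ex by blast
  define x y :: 'a where "x = of_nat m" and "y = of_nat d"
  have nz: "x + 1 \<noteq> 0" "x + 2 \<noteq> 0" "y + 1 \<noteq> 0" "x + y + 1 \<noteq> 0" "x + y + 2 \<noteq> 0"
    using of_nat_neq_0[of m, where 'a='a] of_nat_neq_0[of "m + 1", where 'a='a]
      of_nat_neq_0[of d, where 'a='a] of_nat_neq_0[of "m + d", where 'a='a]
      of_nat_neq_0[of "m + d + 1", where 'a='a]
    by (simp_all add: x_def y_def add_ac)
  define A M D where "A = (fact (k + Suc m) :: 'a)" and "M = (fact m :: 'a)" and "D = (fact d :: 'a)"
  have nz': "M \<noteq> 0" "D \<noteq> 0" by (simp_all add: M_def D_def)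
  have f: "k - m = Suc d" "k - Suc m = d" "fact (Suc d) = (y + 1) * D" "fact (Suc m) = (x + 1) * M"
    "fact (Suc (Suc m)) = (x + 2) * (x + 1) * M" "fact (k + m + 1) = A"
    "fact (k + Suc m + 1) = (2 * x + y + 3) * A" "of_nat k = x + y + 1" "of_nat (k + 1) = x + y + 2"
    "of_nat (Suc d) = y + 1"
    by (simp_all add: x_def y_def M_def D_def A_def k algebra_simps)
  have "(\<Sum>i\<le>Suc m. (-1) ^ i * fact (k + i) / (fact (k - i) * fact i * fact (Suc i))) =
     (-1) ^ m * (y + 1) * A / (((y + 1) * D) * M * ((x + 1) * M) * (x + y + 1) * (x + y + 2))
     - (-1) ^ m * A / (D * ((x + 1) * M) * ((x + 2) * (x + 1) * M))"
    unfolding sum.atMost_Suc Suc.IH[OF Suc_leD[OF Suc.prems]] f A_def[symmetric]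
    by (simp add: M_def[symmetric] D_def[symmetric])
  also have "\<dots> = - ((-1) ^ m * y * ((2 * x + y + 3) * A) /
      (D * ((x + 1) * M) * ((x + 2) * (x + 1) * M) * (x + y + 1) * (x + y + 2)))"
    using nz nz' by (simp add: divide_simps) (simp add: algebra_simps)
  also have "\<dots> = (-1) ^ Suc m * of_nat (k - Suc m) * fact (k + Suc m + 1) /
     (fact (k - Suc m) * fact (Suc m) * fact (Suc (Suc m)) * of_nat k * of_nat (k + 1))"
    unfolding f by (simp add: y_def D_def)
  finally show ?case .
qed

lemma sum_ops_cheb_rec_eq_0:
  assumes "0 < k"
  shows "(\<Sum>j<n. poly (ops (cheb_rec (of_nat n)) k) (of_nat j - (of_nat n - 1) / 2)) = (0::'a::field_char_0)"
proof -
  let ?N = "of_nat n :: 'a"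
  \<comment> \<open>The hockey-stick identity integrates the falling factorial basis.\<close>
  have hockey: "(\<Sum>j<n. (of_nat j gchoose i)) = (of_nat n gchoose Suc i :: 'a)" for i
    by (induction n) (simp_all del: of_nat_Suc flip: binomial_gbinomial)
  \<comment> \<open>The binomial contributes (1-N)_i and the coefficient contributes (i+1-N)_(k-i);
    their product (1-N)_k does not depend on \<open>i\<close>.\<close>
  have summand: "cheb_coeff ?N k i * (fact i * (?N gchoose Suc i)) =
      ?N * pochhammer (1 - ?N) k * ((-1) ^ i * fact (k + i) / (fact (k - i) * fact i * fact (Suc i)))"
    if "i \<le> k" for i
  proof -
    have "(?N gchoose Suc i) = (-1) ^ i * ?N * pochhammer (1 - ?N) i / fact (Suc i)"
      unfolding gbinomial_pochhammer pochhammer_rec[of "- ?N"] by (simp add: add.commute)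
    moreover have "pochhammer (1 - ?N) k = pochhammer (1 - ?N) i * pochhammer (of_nat i + 1 - ?N) (k - i)"
      using pochhammer_product[OF that, of "1 - ?N"] by (simp add: algebra_simps)
    ultimately show ?thesis
      using that by (simp add: cheb_coeff_def power2_eq_square del: fact_Suc)
  qed
  have "(\<Sum>j<n. poly (ops (cheb_rec ?N) k) (of_nat j - (?N - 1) / 2)) =
      fact k ^ 2 / fact (2 * k) * (\<Sum>i\<le>k. cheb_coeff ?N k i * (fact i * (\<Sum>j<n. (of_nat j gchoose i))))"
    unfolding poly_ops_cheb_rec sum_distrib_left by (rule sum.swap)
  also have "(\<Sum>i\<le>k. cheb_coeff ?N k i * (fact i * (\<Sum>j<n. (of_nat j gchoose i)))) =
      (\<Sum>i\<le>k. ?N * pochhammer (1 - ?N) k * ((-1) ^ i * fact (k + i) / (fact (k - i) * fact i * fact (Suc i))))"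
    unfolding hockey by (intro sum.cong refl summand) simp
  also have "\<dots> = 0"
    unfolding sum_distrib_left[symmetric] by (subst alternating_fact_sum) (use assms in auto)
  finally show ?thesis by simp
qed

section \<open>Bernoulli polynomials as power sums\<close>

text \<open>Both equations come from the generating function Q(t) e^(yt) with Q = t/(e^t - 1): the
  first from (e^t - 1) Q = t, the second from Q(-t) = Q(t) e^t.\<close>

lemma
  fixes y :: "'a::field_char_0"
  shows bernoulli_poly_add_1_diff: "poly (bernoulli_poly (Suc m)) (y + 1) - poly (bernoulli_poly (Suc m)) y = of_nat (Suc m) * y ^ m"
    and bernoulli_poly_reflect: "poly (bernoulli_poly m) (1 - y) = (-1) ^ m * poly (bernoulli_poly m) y"
proof -
  let ?E = "fps_exp 1 - 1 :: 'a fps"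
  define Q where "Q = fps_X / ?E"
  have nz: "?E \<noteq> 0" by simp
  \<comment> \<open>The subdegree bound gives divisibility, so the quotient \<open>Q\<close> is
    exact.\<close>
  have "subdegree ?E \<le> 1" by (rule subdegree_leI) simp
  then have dvd: "?E dvd fps_X" by (subst fps_dvd_iff) (use nz in auto)
  then have EQ: "?E * Q = fps_X" by (simp add: Q_def)
  have B: "Abs_fps (\<lambda>n. poly (bernoulli_poly n) x / fact n) = Q * fps_exp x" for x :: 'a
    unfolding bernoulli_poly_gf Q_def using dvd by (metis div_mult_swap mult.commute)
  have "Q * fps_exp (y + 1) - Q * fps_exp y = ?E * Q * fps_exp y"
    by (simp add: fps_exp_add_mult algebra_simps)
  then have "(Q * fps_exp (y + 1) - Q * fps_exp y) $ Suc m = y ^ m / fact m"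
    by (simp only: EQ) simp
  then have diff: "poly (bernoulli_poly (Suc m)) (y + 1) / fact (Suc m) - poly (bernoulli_poly (Suc m)) y / fact (Suc m) =
      y ^ m / fact m"
    unfolding B[symmetric] by (simp del: fact_Suc)
  have "poly (bernoulli_poly (Suc m)) (y + 1) - poly (bernoulli_poly (Suc m)) y =
      fact (Suc m) * (y ^ m / fact m)"
    unfolding diff[symmetric] by (simp add: right_diff_distrib del: fact_Suc)
  then show "poly (bernoulli_poly (Suc m)) (y + 1) - poly (bernoulli_poly (Suc m)) y = of_nat (Suc m) * y ^ m"
    by (simp del: of_nat_Suc)
  have "(fps_exp (-1) - 1) * (Q oo - fps_X) = - fps_X"
    using arg_cong[OF EQ, of "\<lambda>f. f oo - fps_X"]
    by (simp add: fps_compose_mult_distrib fps_compose_sub_distrib)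
  then have "fps_exp 1 * (fps_exp (-1) - 1) * (Q oo - fps_X) = fps_exp 1 * - fps_X"
    by (simp add: mult.assoc)
  moreover have "fps_exp 1 * (fps_exp (-1) - 1) = - ?E"
    using fps_exp_add_mult[of "1::'a" "-1"] by (simp add: algebra_simps)
  ultimately have "?E * (Q oo - fps_X) = fps_exp 1 * fps_X"
    by (metis minus_equation_iff mult_minus_left mult_minus_right)
  also have "\<dots> = ?E * (Q * fps_exp 1)"
    by (subst EQ[symmetric]) (simp only: mult_ac)
  finally have "Q oo - fps_X = Q * fps_exp 1"
    using nz by simp
  then have "(Q * fps_exp y) oo - fps_X = Q * fps_exp (1 - y)"
    using fps_exp_add_mult[of 1 "- y"] by (simp add: fps_compose_mult_distrib mult.assoc)
  then have "((Q * fps_exp y) oo - fps_X) $ m = (Q * fps_exp (1 - y)) $ m"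
    by simp
  then show "poly (bernoulli_poly m) (1 - y) = (-1) ^ m * poly (bernoulli_poly m) y"
    unfolding B[symmetric] fps_compose_uminus' by simp
qed

text \<open>The points (1-N)/2 and (N+1)/2 differ by N and are exchanged by y -> 1 - y. In odd
  degree the telescoped difference is therefore twice the value at (N+1)/2.\<close>

lemma bernoulli_poly_odd_eq_sum:
  fixes n k :: nat
  defines "N \<equiv> of_nat n :: 'a::field_char_0"
  shows "poly (bernoulli_poly (2 * k + 1)) ((N + 1) / 2) / of_nat (2 * k + 1) =
    1 / 2 * (\<Sum>j<n. (of_nat j - (N - 1) / 2) ^ (2 * k))"
proof -
  define y where "y = (1 - N) / 2"
  let ?B = "poly (bernoulli_poly (2 * k + 1)) :: 'a \<Rightarrow> 'a"
  have "?B (y + of_nat m) - ?B y = of_nat (2 * k + 1) * (\<Sum>j<m. (y + of_nat j) ^ (2 * k))" for m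
  proof (induction m)
    case (Suc m)
    have "?B (y + of_nat (Suc m)) - ?B y = (?B ((y + of_nat m) + 1) - ?B (y + of_nat m)) + (?B (y + of_nat m) - ?B y)"
      by (simp add: add_ac)
    also have "\<dots> = of_nat (2 * k + 1) * (\<Sum>j<Suc m. (y + of_nat j) ^ (2 * k))"
      unfolding Suc bernoulli_poly_add_1_diff[of "2 * k", unfolded Suc_eq_plus1]
      by (simp only: sum.lessThan_Suc distrib_left add.commute)
    finally show ?case .
  qed simp
  from this[of n] have "?B (y + N) - ?B y = of_nat (2 * k + 1) * (\<Sum>j<n. (y + of_nat j) ^ (2 * k))"
    by (simp add: N_def)
  moreover have "y + N = (N + 1) / 2" "1 - (N + 1) / 2 = y" "\<And>j. y + of_nat j = of_nat j - (N - 1) / 2"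
    by (simp_all add: y_def field_simps)
  moreover have "?B (1 - (N + 1) / 2) = - ?B ((N + 1) / 2)"
    using bernoulli_poly_reflect[of "2 * k + 1" "(N + 1) / 2"] by simp
  ultimately have "2 * ?B ((N + 1) / 2) = of_nat (2 * k + 1) * (\<Sum>j<n. (of_nat j - (N - 1) / 2) ^ (2 * k))"
    by simp
  moreover have "of_nat (2 * k + 1) \<noteq> (0 :: 'a)"
    unfolding Suc_eq_plus1[symmetric] by (rule of_nat_neq_0)
  moreover have "b / d = 1 / 2 * s" if "2 * b = d * s" "d \<noteq> 0" for b d s :: 'a
    using that by (simp add: field_simps)
  ultimately show ?thesis
    by blast
qed

section \<open>Evaluation at natural numbers and the two determinant formulas\<close>

lemma poly_hankel_det: "poly (hankel_det n c) x = hankel_det n (\<lambda>k. poly (c k) x)"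
proof -
  interpret comm_ring_hom "\<lambda>p. poly p x"
    by unfold_locales simp_all
  have "map_mat (\<lambda>p. poly p x) (mat (n + 1) (n + 1) (\<lambda>(i, j). c (i + j))) =
      mat (n + 1) (n + 1) (\<lambda>(i, j). poly (c (i + j)) x)"
    by (intro eq_matI) auto
  then show ?thesis
    unfolding hankel_det_def by (simp only: hom_det[symmetric])
qed

lemma poly_eqI_of_nat:
  fixes p q :: "'a::field_char_0 poly"
  assumes "\<And>n. poly p (of_nat n) = poly q (of_nat n)"
  shows "p = q"
proof (rule ccontr)
  assume "p \<noteq> q"
  then have "finite {x. poly (p - q) x = 0}"
    by (intro poly_roots_finite) simp
  moreover have "range of_nat \<subseteq> {x. poly (p - q) x = 0}"
    using assms by auto
  ultimately have "finite (range (of_nat :: nat \<Rightarrow> 'a))"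
    by (rule finite_subset[rotated])
  moreover have "infinite (range (of_nat :: nat \<Rightarrow> 'a))"
    by (simp add: finite_image_iff inj_on_def)
  ultimately show False
    by simp
qed

lemma poly_bernoulli_moment:
  fixes x :: "'a::field_char_0"
  shows "poly (smult (1 / of_nat m) (pcompose q (smult (1 / 2) (polyX + 1)))) x =
    poly q ((x + 1) / 2) / of_nat m"
  by (simp add: poly_pcompose add.commute[of 1])

lemma poly_quadratic_factors:
  "poly (smult c ((polyX\<^sup>2 - [:u:]) * (polyX\<^sup>2 - [:v:]))) x = c * ((x\<^sup>2 - u) * (x\<^sup>2 - v))"
  by (simp only: poly_smult poly_mult poly_diff poly_power poly_pCons poly_0 mult_zero_right
      add_0_left add_0_right mult_1_right)

text \<open>Treats both identities at once, \<open>e = 0\<close> and \<open>e = 1\<close>. The first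
  \<open>e\<close> recurrence coefficients are common to all diagonal entries and join the
  prefactor; the rest are grouped in consecutive pairs.\<close>

lemma hankel_det_bernoulli_of_nat:
  fixes N e :: nat
  assumes e: "e \<le> 1"
  defines "x \<equiv> of_nat N :: 'a::field_char_0"
  shows "hankel_det n (\<lambda>k. poly (bernoulli_poly (2 * (k + e) + 1)) ((x + 1) / 2) / of_nat (2 * (k + e) + 1)) =
    (x / 2 * (\<Prod>j=1..e. cheb_rec x j)) ^ (n + 1) *
    (\<Prod>l=1..n. (cheb_rec x (2 * l - 1 + e) * cheb_rec x (2 * l + e)) ^ (n + 1 - l))"
proof -
  \<comment> \<open>The factor 1/2 comes from \<open>bernoulli_poly_odd_eq_sum\<close>, so
    \<open>L 1\<close> is x/2.\<close>
  define L where "L p = 1 / 2 * (\<Sum>j<N. poly p (of_nat j - (x - 1) / 2))" for p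
  interpret favard_functional L "cheb_rec x"
  proof
    show "L (p + q) = L p + L q" for p q
      by (simp add: L_def sum.distrib distrib_left)
    show "L (smult a p) = a * L p" for a p
      by (simp add: L_def sum_distrib_left[symmetric])
    show "L (ops (cheb_rec x) k) = 0" if "0 < k" for k
      using that by (simp only: L_def x_def sum_ops_cheb_rec_eq_0 mult_zero_right)
  qed
  have split: "(\<Prod>j=1..2 * i + e. cheb_rec x j) =
      (\<Prod>j=1..e. cheb_rec x j) * (\<Prod>l=1..i. cheb_rec x (2 * l - 1 + e) * cheb_rec x (2 * l + e))" for i
    by (induction i) (simp_all add: mult_ac)
  have "hankel_det n (\<lambda>k. poly (bernoulli_poly (2 * (k + e) + 1)) ((x + 1) / 2) / of_nat (2 * (k + e) + 1)) =
      hankel_det n (\<lambda>k. L (polyX ^ (2 * k + 2 * e)))"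
    unfolding L_def x_def bernoulli_poly_odd_eq_sum by (simp add: distrib_left)
  also have "\<dots> = (\<Prod>i\<le>n. L 1 * (\<Prod>j=1..2 * i + e. cheb_rec x j))"
    by (rule hankel_det_even_moments[OF e])
  also have "\<dots> = (\<Prod>i\<le>n. (x / 2 * (\<Prod>j=1..e. cheb_rec x j)) *
      (\<Prod>l=1..i. cheb_rec x (2 * l - 1 + e) * cheb_rec x (2 * l + e)))"
    by (simp only: split mult.assoc) (simp add: L_def x_def mult.assoc)
  finally show ?thesis
    by (simp only: prod_prod_partial)
qed

theorem proposition1p4:
  fixes n :: nat
  shows
   "hankel_det n (\<lambda>k. smult (1 / of_nat (2 * k + 1))
         (pcompose (bernoulli_poly (2 * k + 1)) (smult (1 / 2) (polyX + 1))))
     = (smult (1 / 2) polyX :: 'a::field_char_0 poly) ^ (n + 1) *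
       (\<Prod>l = 1..n.
          (smult ((2 * of_nat l)^2 * (2 * of_nat l - 1)^2 /
                  (16 * (4 * of_nat l - 3) * (4 * of_nat l - 1)^2 * (4 * of_nat l + 1)))
             ((polyX^2 - [:(2 * of_nat l - 1)^2:]) * (polyX^2 - [:(2 * of_nat l)^2:])))
          ^ (n + 1 - l)) \<and>
    hankel_det n (\<lambda>k. smult (1 / of_nat (2 * k + 3))
         (pcompose (bernoulli_poly (2 * k + 3)) (smult (1 / 2) (polyX + 1))))
     = (smult (1 / 24) (polyX^3 - polyX) :: 'a poly) ^ (n + 1) *
       (\<Prod>l = 1..n.
          (smult ((2 * of_nat l)^2 * (2 * of_nat l + 1)^2 /
                  (16 * (4 * of_nat l - 1) * (4 * of_nat l + 1)^2 * (4 * of_nat l + 3)))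
             ((polyX^2 - [:(2 * of_nat l + 1)^2:]) * (polyX^2 - [:(2 * of_nat l)^2:])))
          ^ (n + 1 - l))"
proof (intro conjI poly_eqI_of_nat, goal_cases)
  case (1 N)
  define x where "x = (of_nat N :: 'a)"
  have rec: "cheb_rec x (2 * l - 1) * cheb_rec x (2 * l) =
      (2 * of_nat l)^2 * (2 * of_nat l - 1)^2 /
        (16 * (4 * of_nat l - 3) * (4 * of_nat l - 1)^2 * (4 * of_nat l + 1)) *
      ((x^2 - (2 * of_nat l - 1)^2) * (x^2 - (2 * of_nat l)^2))" if "1 \<le> l" for l
  proof -
    define a :: 'a where "a = of_nat l"
    have o: "of_nat (2 * l - 1) = 2 * a - 1" "of_nat (2 * l) = 2 * a" "of_nat l = a"
      using that by (simp_all add: of_nat_diff a_def)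
    \<comment> \<open>The neighbouring denominators share the factor 4l - 1, which explains its
      square in the formula.\<close>
    have d: "4 * (4 * (2 * a - 1)\<^sup>2 - 1) = 4 * ((4 * a - 3) * (4 * a - 1))"
      "4 * (4 * (2 * a)\<^sup>2 - 1) = 4 * ((4 * a - 1) * (4 * a + 1))"
      by (simp_all add: algebra_simps power2_eq_square)
    have "s * u / (4 * (p * q)) * (t * v / (4 * (q * r))) = t * s / (16 * p * q\<^sup>2 * r) * (u * v)"
      for p q r s t u v :: 'a
      by (simp add: power2_eq_square mult_ac)
    then show ?thesis
      unfolding cheb_rec_def o d .
  qed
  show ?case
    unfolding poly_mult poly_power poly_prod poly_hankel_det poly_bernoulli_moment
      hankel_det_bernoulli_of_nat[OF zero_le_one, unfolded add_0_right]
    unfolding x_def[symmetric]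
    by (intro arg_cong2[of _ _ _ _ "(*)"] prod.cong refl)
       (simp_all only: poly_quadratic_factors rec atLeastAtMost_iff, simp)
next
  case (2 N)
  define x where "x = (of_nat N :: 'a)"
  have rec: "cheb_rec x (2 * l) * cheb_rec x (2 * l + 1) =
      (2 * of_nat l)^2 * (2 * of_nat l + 1)^2 /
        (16 * (4 * of_nat l - 1) * (4 * of_nat l + 1)^2 * (4 * of_nat l + 3)) *
      ((x^2 - (2 * of_nat l + 1)^2) * (x^2 - (2 * of_nat l)^2))" for l
  proof -
    define a :: 'a where "a = of_nat l"
    have o: "of_nat (2 * l + 1) = 2 * a + 1" "of_nat (2 * l) = 2 * a" "of_nat l = a"
      by (simp_all add: a_def)
    have d: "4 * (4 * (2 * a + 1)\<^sup>2 - 1) = 4 * ((4 * a + 1) * (4 * a + 3))"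
      "4 * (4 * (2 * a)\<^sup>2 - 1) = 4 * ((4 * a - 1) * (4 * a + 1))"
      by (simp_all add: algebra_simps power2_eq_square)
    have "s * u / (4 * (p * q)) * (t * v / (4 * (q * r))) = s * t / (16 * p * q\<^sup>2 * r) * (v * u)"
      for p q r s t u v :: 'a
      by (simp add: power2_eq_square mult_ac)
    then show ?thesis
      unfolding cheb_rec_def o d .
  qed
  \<comment> \<open>The first recurrence coefficient is (x^2 - 1)/12.\<close>
  have lead: "x / 2 * (\<Prod>j=1..1. cheb_rec x j) = poly (smult (1 / 24) (polyX ^ 3 - polyX)) x"
    by (simp add: cheb_rec_def field_simps power2_eq_square power3_eq_cube)
  \<comment> \<open>Exposes the second family as the case \<open>e = 1\<close>.\<close>
  have shift: "2 * k + 3 = 2 * (k + 1) + 1" for k :: nat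
    by simp
  have index: "2 * l - 1 + 1 = 2 * l" if "l \<in> {1..n}" for l :: nat
    using that by simp
  show ?case
    unfolding poly_mult poly_power poly_prod poly_hankel_det shift poly_bernoulli_moment
      hankel_det_bernoulli_of_nat[OF order_refl]
    unfolding x_def[symmetric]
    by (intro arg_cong2[of _ _ _ _ "(*)"] prod.cong refl)
       (simp_all only: poly_quadratic_factors rec index lead)
qed

end
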